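(* Let $P_X,P_Y$ be two probability distributions on $\{-1,1\}$ and let $\mathcal{U}$ and $\mathcal{V}$ be finite sets. Then, for any $Q_{U,V}\in\mathcal{P}_{CR}(P_XP_Y,\mathcal{U},\mathcal{V})$ with marginals $Q_U,Q_V$, the following holds for all $i,j\in\mathcal{U}\cap\mathcal{V}$: $$\big(Q_{U,V}(i,i)-Q_U(i)Q_V(i)\big)\big(Q_{U,V}(j,j)-Q_U(j)Q_V(j)\big)=\big(Q_{U,V}(i,j)-Q_U(i)Q_V(j)\big)\big(Q_{U,V}(j,i)-Q_U(j)Q_V(i)\big).$$
   Context: $P_XP_Y$ denotes the product distribution on $\{-1,1\}^2$. A stochastic function is a function whose output may also depend on private randomness, independent of everything else (in particular, the private randomness of Alice and that of Bob are independent); equivalently, a Markov kernel from inputs to outputs. $d_{TV}$ is total variation distance. Common-randomness simulation (CR-NISS). For a distribution $P_{X,Y}$ on $\{-1,1\}^2$ and finite sets $\mathcal{U},\mathcal{V}$, $\mathcal{P}_{CR}(P_{X,Y},\mathcal{U},\mathcal{V})$ is the set of distributions $Q_{U,V}$ on $\mathcal{U}\times\mathcal{V}$ for which there exist, for each $d\in\mathbb{N}$, (possibly stochastic) functions $f_d:\{-1,1\}^{d+1}\to\mathcal{U}$ and $g_d:\{-1,1\}^{d+1}\to\mathcal{V}$ such that the law $P^{(d)}$ of $(f_d(Z,X^d),g_d(Z,Y^d))$ satisfies $\lim_{d\to\infty}d_{TV}(P^{(d)},Q_{U,V})=0$, where $(X^d,Y^d)=((X_1,Y_1),\dots,(X_d,Y_d))$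 is i.i.d. with law $P_{X,Y}$, and $Z$ is uniform on $\{-1,1\}$ and independent of $(X^d,Y^d)$. *)

theory Defs
  imports "HOL-Probability.Probability"
begin

definition signs :: "int set" where
  "signs = {-1, 1}"

definition sign_vectors :: "nat \<Rightarrow> int list set" where
  "sign_vectors n = {xs. length xs = n \<and> set xs \<subseteq> signs}"

definition tv_dist :: "'a pmf \<Rightarrow> 'a pmf \<Rightarrow> real" where
  "tv_dist P Q = (SUP A. \<bar>measure_pmf.prob P A - measure_pmf.prob Q A\<bar>)"

(* Markov kernels from A to B; the values outside A are irrelevant. *)
definition stochastic_functions :: "'a set \<Rightarrow> 'b set \<Rightarrow> ('a \<Rightarrow> 'b pmf) set" where
  "stochastic_functions A B = {k. \<forall>x\<in>A. set_pmf (k x) \<subseteq> B}"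

(* Law of (f(Z, X^d), g(Z, Y^d)). Given the inputs, f and g are sampled independently
   of each other: this is the independence of the two parties' private randomness. *)
definition cr_law ::
  "(int \<times> int) pmf \<Rightarrow> nat \<Rightarrow> (int list \<Rightarrow> 'u pmf) \<Rightarrow> (int list \<Rightarrow> 'v pmf) \<Rightarrow> ('u \<times> 'v) pmf" where
  "cr_law P d f g = do {
     z \<leftarrow> pmf_of_set signs;
     xys \<leftarrow> replicate_pmf d P;
     u \<leftarrow> f (z # map fst xys);
     v \<leftarrow> g (z # map snd xys);
     return_pmf (u, v)
   }"

definition P_CR :: "(int \<times> int) pmf \<Rightarrow> 'u set \<Rightarrow> 'v set \<Rightarrow> ('u \<times> 'v) pmf set" where
  "P_CR P U V = {Q. set_pmf Q \<subseteq> U \<times> V \<and>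
     (\<exists>f g. (\<forall>d. f d \<in> stochastic_functions (sign_vectors (d + 1)) U \<and>
                 g d \<in> stochastic_functions (sign_vectors (d + 1)) V) \<and>
            (\<lambda>d. tv_dist (cr_law P d (f d) (g d)) Q) \<longlonglongrightarrow> 0)}"

end

theory Submission
  imports Defs
begin

text \<open>Given \<^term>\<open>Z\<close>, the inputs \<^term>\<open>X\<close> and \<^term>\<open>Y\<close> are independent, so every simulated law is an equal mixture
  of two product laws. The covariance matrix of such a mixture is a quarter of the outer product
  of the differences of the marginals, so it has rank at most one and its \<open>2 \<times> 2\<close> minors vanish.
  This is preserved in the limit.\<close>

lemma tv_dist_ge: "\<bar>measure_pmf.prob P A - measure_pmf.prob Q A\<bar> \<le> tv_dist P Q"
  unfolding tv_dist_def
proof (rule cSUP_upper)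
  show "bdd_above (range (\<lambda>A. \<bar>measure_pmf.prob P A - measure_pmf.prob Q A\<bar>))"
    by (rule bdd_aboveI[where M = 1])
      (auto simp: abs_le_iff intro!: measure_pmf.prob_le_1 diff_le_eq[THEN iffD2] add_increasing2)
qed simp

text \<open>The only consequence of the simulation hypothesis that is used: atoms and marginals are
  probabilities of events, so they pass to the limit.\<close>

lemma tendsto_prob_of_tv_dist:
  assumes "((\<lambda>d. tv_dist (P d) Q) \<longlongrightarrow> 0) F"
  shows "((\<lambda>d. measure_pmf.prob (P d) A) \<longlongrightarrow> measure_pmf.prob Q A) F"
proof (rule Lim_transform2[OF tendsto_const])
  show "((\<lambda>d. measure_pmf.prob Q A - measure_pmf.prob (P d) A) \<longlongrightarrow> 0) F"
    by (rule Lim_null_comparison[OF _ assms])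
      (simp add: tv_dist_ge abs_minus_commute[of "measure_pmf.prob Q A"])
qed

text \<open>This separates the two parties' inputs: under a product law, Alice's list carries no
  information about Bob's.\<close>

lemma replicate_pmf_pair:
  "map_pmf (\<lambda>xys. (map fst xys, map snd xys)) (replicate_pmf d (pair_pmf P Q)) =
     pair_pmf (replicate_pmf d P) (replicate_pmf d Q)"
proof (induction d)
  case (Suc d)
  have "map_pmf (\<lambda>xys. (map fst xys, map snd xys)) (replicate_pmf (Suc d) (pair_pmf P Q)) =
     do {x \<leftarrow> P; y \<leftarrow> Q;
         (xs, ys) \<leftarrow> map_pmf (\<lambda>xys. (map fst xys, map snd xys)) (replicate_pmf d (pair_pmf P Q));
         return_pmf (x # xs, y # ys)}"
    by (simp add: pair_pmf_def map_pmf_def bind_assoc_pmf bind_return_pmf)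
  also have "\<dots> = do {x \<leftarrow> P; y \<leftarrow> Q; xs \<leftarrow> replicate_pmf d P; ys \<leftarrow> replicate_pmf d Q;
         return_pmf (x # xs, y # ys)}"
    by (simp add: Suc.IH) (simp add: pair_pmf_def bind_assoc_pmf bind_return_pmf)
  \<comment> \<open>The draw of \<open>y\<close> does not affect that of \<open>xs\<close>, so the
    two can be exchanged, which groups all of Alice's draws before Bob's.\<close>
  also have "\<dots> = pair_pmf (replicate_pmf (Suc d) P) (replicate_pmf (Suc d) Q)"
    by (simp add: pair_pmf_def bind_assoc_pmf bind_return_pmf bind_commute_pmf[of Q])
  finally show ?case .
qed (simp add: pair_return_pmf1)

lemma cr_law_pair_pmf:
  "cr_law (pair_pmf P Q) d f g = do {
     z \<leftarrow> pmf_of_set signs;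
     pair_pmf (replicate_pmf d P \<bind> (\<lambda>xs. f (z # xs))) (replicate_pmf d Q \<bind> (\<lambda>ys. g (z # ys)))}"
proof -
  have "cr_law (pair_pmf P Q) d f g = do {
     z \<leftarrow> pmf_of_set signs;
     (xs, ys) \<leftarrow> map_pmf (\<lambda>xys. (map fst xys, map snd xys)) (replicate_pmf d (pair_pmf P Q));
     pair_pmf (f (z # xs)) (g (z # ys))}"
    by (simp add: cr_law_def pair_pmf_def bind_map_pmf)
  \<comment> \<open>Alice's output depends on \<open>z\<close> and \<open>xs\<close> only, so it can
    be drawn before \<open>ys\<close>.\<close>
  also have "\<dots> = do {
     z \<leftarrow> pmf_of_set signs;
     pair_pmf (replicate_pmf d P \<bind> (\<lambda>xs. f (z # xs))) (replicate_pmf d Q \<bind> (\<lambda>ys. g (z # ys)))}"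
    unfolding replicate_pmf_pair
    by (simp add: pair_pmf_def bind_assoc_pmf bind_return_pmf
        bind_commute_pmf[of "replicate_pmf d Q" "f _"])
  finally show ?thesis .
qed

lemma pmf_bind_signs: "pmf (pmf_of_set signs \<bind> K) x = (pmf (K 1) x + pmf (K (-1)) x) / 2"
  by (simp add: signs_def pmf_bind integral_pmf_of_set field_simps)

text \<open>Each marginal of the mixture is the mixture of the marginals, which leaves \<open>(a b +
  a' b') / 2 - (a + a') (b + b') / 4 = (a - a') (b - b') / 4\<close>.\<close>

lemma covariance_mixture_of_products:
  fixes A :: "int \<Rightarrow> 'a pmf" and B :: "int \<Rightarrow> 'b pmf"
  defines "M \<equiv> pmf_of_set signs \<bind> (\<lambda>z. pair_pmf (A z) (B z))"
  shows "pmf M (u, v) - pmf (map_pmf fst M) u * pmf (map_pmf snd M) v =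
    (pmf (A 1) u - pmf (A (-1)) u) * (pmf (B 1) v - pmf (B (-1)) v) / 4"
  unfolding M_def
  by (simp add: map_bind_pmf map_fst_pair_pmf map_snd_pair_pmf pmf_bind_signs pmf_pair field_simps)

theorem proposition4:
  fixes PX PY :: "int pmf" and U V :: "'a set" and Q :: "('a \<times> 'a) pmf"
    and QU QV :: "'a pmf" and i j :: 'a
  assumes "set_pmf PX \<subseteq> signs" and "set_pmf PY \<subseteq> signs"
    and "finite U" and "finite V"
    and "Q \<in> P_CR (pair_pmf PX PY) U V"
    and "QU = map_pmf fst Q" and "QV = map_pmf snd Q"
    and "i \<in> U \<inter> V" and "j \<in> U \<inter> V"
  shows "(pmf Q (i, i) - pmf QU i * pmf QV i) * (pmf Q (j, j) - pmf QU j * pmf QV j)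
       = (pmf Q (i, j) - pmf QU i * pmf QV j) * (pmf Q (j, i) - pmf QU j * pmf QV i)"
proof -
  obtain f g where fg: "(\<lambda>d. tv_dist (cr_law (pair_pmf PX PY) d (f d) (g d)) Q) \<longlonglongrightarrow> 0"
    using assms(5) unfolding P_CR_def by blast
  define L where "L d = cr_law (pair_pmf PX PY) d (f d) (g d)" for d
  \<comment> \<open>Under \<open>M\<close>, this is the covariance of the indicators of first
    coordinate \<open>u\<close> and second coordinate \<open>v\<close>.\<close>
  define C where "C M u v = pmf M (u, v) - pmf (map_pmf fst M) u * pmf (map_pmf snd M) v"
    for M :: "('a \<times> 'a) pmf" and u v
  have lim: "(\<lambda>d. C (L d) u v) \<longlonglongrightarrow> C Q u v" for u v
    \<comment> \<open>Marginals must become probabilities of fibres under the joint law before the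
      remaining atoms become probabilities of singletons.\<close>
    unfolding C_def L_def pmf_map
    unfolding measure_pmf_single[symmetric]
    by (intro tendsto_diff tendsto_mult tendsto_prob_of_tv_dist fg)
  \<comment> \<open>Both sides multiply the same four differences of marginals, over 16.\<close>
  have "C (L d) i i * C (L d) j j = C (L d) i j * C (L d) j i" for d
    unfolding C_def L_def cr_law_pair_pmf covariance_mixture_of_products by (simp add: mult_ac)
  \<comment> \<open>One sequence thus has both sides of the claim as limits.\<close>
  then have "(\<lambda>d. C (L d) i i * C (L d) j j) \<longlonglongrightarrow> C Q i j * C Q j i"
    by (simp add: tendsto_mult lim)
  then have "C Q i i * C Q j j = C Q i j * C Q j i"
    by (rule LIMSEQ_unique[OF tendsto_mult[OF lim lim]])
  then show ?thesis
    by (simp add: C_def assms(6,7))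
qed

end
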